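(* Let $1\leq k\leq n$ and let $G$ be an acyclic graph on $n$ vertices with exactly $k$ connected components. Then $$F(G)\leq 2^{n-k}+n-1,$$ with equality if and only if $G$ is isomorphic to $(k-1)K_1\cup K_{1,n-k}$.
   Context: All graphs are finite, simple and undirected. A connected subgraph of a graph $G=(V,E)$ is a graph $(V',E')$ with $\emptyset\neq V'\subseteq V$, $E'\subseteq E$, every edge of $E'$ having both endpoints in $V'$, and $(V',E')$ connected; distinct pairs $(V',E')$ are counted separately. The core index $F(G)$ is the number of connected subgraphs of $G$ (for a disconnected graph it is the sum over its components). $K_{1,m}$ is the star with $m$ leaves ($K_{1,0}=K_1$), $\cup$ denotes disjoint union and $mG$ the disjoint union of $m$ copies of $G$. *)

theory Defs
  imports Main
begin

type_synonym 'a graph = "'a set \<times> 'a set set"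

abbreviation verts :: "'a graph \<Rightarrow> 'a set" where
  "verts G \<equiv> fst G"

abbreviation edges :: "'a graph \<Rightarrow> 'a set set" where
  "edges G \<equiv> snd G"

definition simple_graph :: "'a graph \<Rightarrow> bool" where
  "simple_graph G \<longleftrightarrow> finite (verts G) \<and> (\<forall>e\<in>edges G. e \<subseteq> verts G \<and> card e = 2)"

definition adj :: "'a graph \<Rightarrow> 'a \<Rightarrow> 'a \<Rightarrow> bool" where
  "adj G u v \<longleftrightarrow> {u, v} \<in> edges G"

definition connected_graph :: "'a graph \<Rightarrow> bool" where
  "connected_graph G \<longleftrightarrow>
     verts G \<noteq> {} \<and> (\<forall>u\<in>verts G. \<forall>v\<in>verts G. (adj G)\<^sup>*\<^sup>* u v)"

text \<open>A cycle is given by the list of its pairwise distinct vertices in cyclic order.\<close>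

definition is_cycle :: "'a graph \<Rightarrow> 'a list \<Rightarrow> bool" where
  "is_cycle G c \<longleftrightarrow>
     length c \<ge> 3 \<and> distinct c \<and> successively (adj G) c \<and> adj G (last c) (hd c)"

definition acyclic_graph :: "'a graph \<Rightarrow> bool" where
  "acyclic_graph G \<longleftrightarrow> \<not> (\<exists>c. is_cycle G c)"

definition subgraph :: "'a graph \<Rightarrow> 'a graph \<Rightarrow> bool" where
  "subgraph H G \<longleftrightarrow>
     verts H \<subseteq> verts G \<and> edges H \<subseteq> edges G \<and> (\<forall>e\<in>edges H. e \<subseteq> verts H)"

definition connected_subgraphs :: "'a graph \<Rightarrow> 'a graph set" where
  "connected_subgraphs G = {H. subgraph H G \<and> connected_graph H}"

definition core_index :: "'a graph \<Rightarrow> nat" where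
  "core_index G = card (connected_subgraphs G)"

definition graph_components :: "'a graph \<Rightarrow> 'a graph set" where
  "graph_components G =
     {C \<in> connected_subgraphs G. \<forall>H\<in>connected_subgraphs G. subgraph C H \<longrightarrow> H = C}"

definition graph_iso :: "'a graph \<Rightarrow> 'b graph \<Rightarrow> bool" where
  "graph_iso G H \<longleftrightarrow>
     (\<exists>f. bij_betw f (verts G) (verts H) \<and>
          (\<forall>u\<in>verts G. \<forall>v\<in>verts G. adj G u v \<longleftrightarrow> adj H (f u) (f v)))"

definition disjoint_union :: "'a graph \<Rightarrow> 'b graph \<Rightarrow> ('a + 'b) graph" where
  "disjoint_union G H =
     (verts G <+> verts H, (`) Inl ` edges G \<union> (`) Inr ` edges H)"

text \<open>The disjoint union of \<open>m\<close> copies of \<open>G\<close>; the vertex \<open>(i, v)\<close> is \<open>v\<close> in the \<open>i\<close>-th copy.\<close>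

definition graph_copies :: "nat \<Rightarrow> 'a graph \<Rightarrow> (nat \<times> 'a) graph" where
  "graph_copies m G = ({..<m} \<times> verts G, (\<Union>i<m. (`) (Pair i) ` edges G))"

definition K1 :: "nat graph" where
  "K1 = ({0}, {})"

text \<open>The star \<open>K\<^sub>1\<^sub>,\<^sub>m\<close> with centre \<open>0\<close> and leaves \<open>1, \<dots>, m\<close>.\<close>

definition star_graph :: "nat \<Rightarrow> nat graph" where
  "star_graph m = ({0..m}, (\<lambda>i. {0, i}) ` {1..m})"

lemma star_graph_0: "star_graph 0 = K1"
  by (simp add: star_graph_def K1_def)

lemma subgraph_trans: "subgraph H K \<Longrightarrow> subgraph K G \<Longrightarrow> subgraph H G"
  unfolding subgraph_def by blast

lemma adj_rtranclp_mono:
  assumes "(adj H)\<^sup>*\<^sup>* u v" "edges H \<subseteq> edges K"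
  shows "(adj K)\<^sup>*\<^sup>* u v"
proof -
  have "adj H \<le> adj K" using assms(2) unfolding adj_def by blast
  from rtranclp_mono[OF this] assms(1) show ?thesis by blast
qed

lemma finite_connected_subgraphs:
  assumes "simple_graph G"
  shows "finite (connected_subgraphs G)"
proof -
  have "edges G \<subseteq> Pow (verts G)" "finite (verts G)"
    using assms unfolding simple_graph_def by auto
  then have "finite (Pow (verts G) \<times> Pow (edges G))"
    by (meson finite_Pow_iff finite_SigmaI finite_subset)
  moreover have "connected_subgraphs G \<subseteq> Pow (verts G) \<times> Pow (edges G)"
    unfolding connected_subgraphs_def subgraph_def by auto
  ultimately show ?thesis by (rule finite_subset[rotated])
qed

lemma connected_subgraphs_Un:
  assumes "A \<in> connected_subgraphs G" "B \<in> connected_subgraphs G"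
    and "verts A \<inter> verts B \<noteq> {}"
  shows "(verts A \<union> verts B, edges A \<union> edges B) \<in> connected_subgraphs G" (is "?U \<in> _")
proof -
  obtain w where w: "w \<in> verts A" "w \<in> verts B" using assms(3) by blast
  have *: "(adj ?U)\<^sup>*\<^sup>* u w \<and> (adj ?U)\<^sup>*\<^sup>* w u" if u: "u \<in> verts A \<union> verts B" for u
  proof (cases "u \<in> verts A")
    case True
    then have "(adj A)\<^sup>*\<^sup>* u w" "(adj A)\<^sup>*\<^sup>* w u"
      using assms(1) w unfolding connected_subgraphs_def connected_graph_def by auto
    then show ?thesis using adj_rtranclp_mono[of A _ _ ?U] by auto
  next
    case False
    then have "u \<in> verts B" using u by simp
    then have "(adj B)\<^sup>*\<^sup>* u w" "(adj B)\<^sup>*\<^sup>* w u"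
      using assms(2) w unfolding connected_subgraphs_def connected_graph_def by auto
    then show ?thesis using adj_rtranclp_mono[of B _ _ ?U] by auto
  qed
  have "(adj ?U)\<^sup>*\<^sup>* u v" if "u \<in> verts ?U" "v \<in> verts ?U" for u v
    using *[of u] *[of v] that by (auto intro: rtranclp_trans)
  then have "connected_graph ?U"
    using w unfolding connected_graph_def by auto
  moreover have "subgraph ?U G"
    using assms(1,2) unfolding connected_subgraphs_def subgraph_def by auto
  ultimately show ?thesis unfolding connected_subgraphs_def by blast
qed

lemma connected_subgraph_in_component:
  assumes "simple_graph G" "H \<in> connected_subgraphs G"
  shows "\<exists>C\<in>graph_components G. subgraph H C"
proof -
  let ?S = "{K \<in> connected_subgraphs G. subgraph H K}"
  let ?m = "\<lambda>K::'a graph. card (verts K) + card (edges K)"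
  have sH: "subgraph H H"
    using assms(2) unfolding connected_subgraphs_def subgraph_def by auto
  have finS: "finite ?S" using finite_connected_subgraphs[OF assms(1)] by simp
  moreover have "?S \<noteq> {}" using assms(2) sH by blast
  ultimately obtain C where C: "C \<in> ?S" and max: "Max (?m ` ?S) = ?m C"
    by (rule obtains_MAX)
  have fin: "finite (verts G)" "finite (edges G)"
    using assms(1) unfolding simple_graph_def
    by (auto intro: finite_subset[of _ "Pow (verts G)"])
  have "K = C" if K: "K \<in> connected_subgraphs G" "subgraph C K" for K
  proof -
    have "K \<in> ?S" using K C subgraph_trans by blast
    then have le: "?m K \<le> ?m C"
      unfolding max[symmetric] using finS by (intro Max_ge finite_imageI imageI)
    have sub: "verts C \<subseteq> verts K" "edges C \<subseteq> edges K" using K(2) unfolding subgraph_def by auto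
    have "verts K \<subseteq> verts G" "edges K \<subseteq> edges G"
      using K(1) unfolding connected_subgraphs_def subgraph_def by auto
    then have f: "finite (verts K)" "finite (edges K)" using fin finite_subset by auto
    have "card (verts C) \<le> card (verts K)" "card (edges C) \<le> card (edges K)"
      using card_mono f sub by auto
    then have "verts C = verts K" "edges C = edges K"
      using le card_subset_eq[OF f(1) sub(1)] card_subset_eq[OF f(2) sub(2)] by auto
    then show ?thesis by (simp add: prod_eq_iff)
  qed
  then show ?thesis using C unfolding graph_components_def by blast
qed

lemma graph_components_disjoint:
  assumes "C \<in> graph_components G" "D \<in> graph_components G" "C \<noteq> D"
  shows "verts C \<inter> verts D = {}"
proof (rule ccontr)
  assume "verts C \<inter> verts D \<noteq> {}"
  let ?U = "(verts C \<union> verts D, edges C \<union> edges D)"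
  have CD: "C \<in> connected_subgraphs G" "D \<in> connected_subgraphs G"
    using assms unfolding graph_components_def by auto
  then have U: "?U \<in> connected_subgraphs G"
    using connected_subgraphs_Un \<open>verts C \<inter> verts D \<noteq> {}\<close> by blast
  have "subgraph C ?U" "subgraph D ?U"
    using CD unfolding connected_subgraphs_def subgraph_def by auto
  then have "?U = C" "?U = D" using assms(1,2) U unfolding graph_components_def by auto
  then show False using assms(3) by simp
qed

lemma core_index_sum_components:
  assumes "simple_graph G"
  shows "core_index G = (\<Sum>C\<in>graph_components G. core_index C)"
proof -
  have sub: "connected_subgraphs C \<subseteq> connected_subgraphs G" if "C \<in> graph_components G" for C
    using that subgraph_trans unfolding graph_components_def connected_subgraphs_def by blast
  have fin: "finite (graph_components G)"
    using finite_connected_subgraphs[OF assms] unfolding graph_components_def by simp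
  have "connected_subgraphs G \<subseteq> (\<Union>C\<in>graph_components G. connected_subgraphs C)"
  proof
    fix H assume H: "H \<in> connected_subgraphs G"
    then obtain C where "C \<in> graph_components G" "subgraph H C"
      using connected_subgraph_in_component[OF assms] by blast
    then show "H \<in> (\<Union>C\<in>graph_components G. connected_subgraphs C)"
      using H unfolding connected_subgraphs_def by blast
  qed
  with sub have eq: "connected_subgraphs G = (\<Union>C\<in>graph_components G. connected_subgraphs C)"
    by blast
  have disj: "connected_subgraphs C \<inter> connected_subgraphs D = {}"
    if CD: "C \<in> graph_components G" "D \<in> graph_components G" "C \<noteq> D" for C D
  proof -
    have "verts H \<noteq> {} \<and> verts H \<subseteq> verts C \<inter> verts D"
      if "H \<in> connected_subgraphs C" "H \<in> connected_subgraphs D" for H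
      using that unfolding connected_subgraphs_def subgraph_def connected_graph_def by auto
    then show ?thesis using graph_components_disjoint[OF CD] by blast
  qed
  show ?thesis
    unfolding core_index_def eq
  proof (rule card_UN_disjoint[OF fin])
    show "\<forall>C\<in>graph_components G. finite (connected_subgraphs C)"
      using sub finite_connected_subgraphs[OF assms] finite_subset by metis
  qed (use disj in blast)
qed

end

theory Submission
  imports Defs
begin

text \<open>A connected subgraph is either a single vertex or the union of its nonempty edge set. Hence a
  graph with \<open>n\<close> vertices and \<open>m\<close> edges has at most \<open>n + (2\<^sup>m - 1)\<close> connected subgraphs,
  with equality iff every nonempty set of edges spans a connected graph, that is, iff any two edges
  meet. Without triangles the latter means that all edges share a vertex. Finally \<open>m \<le> n - k\<close> in
  a forest with \<open>k\<close> components: deleting an edge \<open>uv\<close> of a forest separates \<open>u\<close> from \<open>v\<close>,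
  so a set of pairwise unreachable vertices can then be enlarged by \<open>u\<close> or by \<open>v\<close>.\<close>

section \<open>Adjacency and edges in simple graphs\<close>

lemma adj_sym: "adj G u v \<Longrightarrow> adj G v u"
  by (simp add: adj_def insert_commute)

lemma reach_sym: "(adj G)\<^sup>*\<^sup>* u v \<Longrightarrow> (adj G)\<^sup>*\<^sup>* v u"
  by (metis adj_sym symp_def symp_rtranclp)

lemma finite_edges: "simple_graph G \<Longrightarrow> finite (edges G)"
  unfolding simple_graph_def by (auto intro: finite_subset[of _ "Pow (verts G)"])

lemma simple_adjD:
  assumes "simple_graph G" "adj G u v"
  shows "u \<in> verts G" "v \<in> verts G" "u \<noteq> v"
proof -
  have "{u, v} \<subseteq> verts G" "card {u, v} = 2"
    using assms unfolding simple_graph_def adj_def by blast+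
  then show "u \<in> verts G" "v \<in> verts G" "u \<noteq> v" by (auto split: if_splits)
qed

lemma edge_cases:
  assumes "simple_graph G" "e \<in> edges G"
  obtains u v where "e = {u, v}" "u \<noteq> v" "u \<in> verts G" "v \<in> verts G"
  using assms unfolding simple_graph_def by (auto simp: card_2_iff)

lemma edge_through:
  assumes "simple_graph G" "e \<in> edges G" "u \<in> e"
  obtains v where "e = {u, v}" "u \<noteq> v" "v \<in> verts G"
proof -
  obtain a b where "e = {a, b}" "a \<noteq> b" "a \<in> verts G" "b \<in> verts G"
    using edge_cases[OF assms(1,2)] .
  then show thesis using that[of a] that[of b] assms(3) by (auto simp: insert_commute)
qed

subsection \<open>Edges and components of a forest\<close>

text \<open>The path is built from its end \<open>v\<close> backwards. If the new first vertex
  \<open>x\<close> already occurs on it, the part before that occurrence is dropped, so no vertex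
  repeats.\<close>

lemma reach_distinct_path:
  assumes "R\<^sup>*\<^sup>* u v"
  shows "\<exists>p. p \<noteq> [] \<and> hd p = u \<and> last p = v \<and> distinct p \<and> successively R p"
  using assms
proof (induction rule: converse_rtranclp_induct)
  case base
  show ?case by (rule exI[of _ "[v]"]) simp
next
  case (step x y)
  then obtain p where p: "p \<noteq> []" "hd p = y" "last p = v" "distinct p" "successively R p"
    by blast
  show ?case
  proof (cases "x \<in> set p")
    case True
    then obtain q r where "p = q @ x # r" by (meson split_list)
    then show ?thesis using p(3-5)
      by (intro exI[of _ "x # r"]) (simp add: successively_append_iff)
  next
    case False
    then show ?thesis using p step.hyps(1)
      by (intro exI[of _ "x # p"]) (simp add: successively_Cons)
  qed
qed

text \<open>A path from \<open>u\<close> to \<open>v\<close> with edges in \<open>F\<close> would be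
  closed to a cycle by the edge \<open>{u, v}\<close>.\<close>

lemma acyclic_edge_separates:
  assumes "acyclic_graph (V, insert {u, v} F)" "{u, v} \<notin> F" "u \<noteq> v"
  shows "\<not> (adj (V, F))\<^sup>*\<^sup>* u v"
proof
  assume "(adj (V, F))\<^sup>*\<^sup>* u v"
  then obtain p where p: "p \<noteq> []" "hd p = u" "last p = v" "distinct p" "successively (adj (V, F)) p"
    using reach_distinct_path[of "adj (V, F)" u v] by blast
  \<comment> \<open>One vertex would give \<open>u = v\<close>, and two would put
    \<open>{u, v}\<close> into \<open>F\<close>.\<close>
  have "length p \<ge> 3"
  proof (cases p rule: remdups_adj.cases)
    case (3 a b r)
    then show ?thesis using p assms(2) by (cases r) (auto simp: adj_def)
  qed (use p assms(3) in auto)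
  moreover have "successively (adj (V, insert {u, v} F)) p"
    using p(5) by (rule successively_mono) (auto simp: adj_def)
  ultimately have "is_cycle (V, insert {u, v} F) p"
    using p(2-4) unfolding is_cycle_def by (simp add: adj_def insert_commute[of v u])
  then show False using assms(1) unfolding acyclic_graph_def by blast
qed

lemma acyclic_graph_mono:
  assumes "acyclic_graph (V, F)" "E \<subseteq> F"
  shows "acyclic_graph (W, E)"
proof -
  have "is_cycle (V, F) c" if "is_cycle (W, E) c" for c
  proof -
    have "successively (adj (V, F)) c"
    proof (rule successively_mono)
      show "successively (adj (W, E)) c" using that unfolding is_cycle_def by blast
    qed (use assms(2) in \<open>auto simp: adj_def\<close>)
    then show ?thesis using that assms(2) unfolding is_cycle_def by (auto simp: adj_def)
  qed
  then show ?thesis using assms(1) unfolding acyclic_graph_def by blast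
qed

text \<open>\<open>S\<close> varies in the induction over \<open>F\<close>: each deleted edge is
  paid for by one new element of \<open>S\<close>. Old elements stay mutually unreachable because
  fewer edges give less reachability. Without edges the claim is
  \<open>S \<subseteq> V\<close>.\<close>

lemma forest_edges_plus_unreachable_le:
  assumes "finite F" "finite V" "\<forall>e\<in>F. e \<subseteq> V \<and> card e = 2" "acyclic_graph (V, F)"
    and "S \<subseteq> V" "\<And>s t. \<lbrakk>s \<in> S; t \<in> S; (adj (V, F))\<^sup>*\<^sup>* s t\<rbrakk> \<Longrightarrow> s = t"
  shows "card F + card S \<le> card V"
  using assms(1,3-)
proof (induction F arbitrary: S rule: finite_induct)
  case empty
  then show ?case using assms(2) by (simp add: card_mono)
next
  case (insert e F)
  let ?R = "adj (V, F)" and ?R' = "adj (V, insert e F)"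
  obtain u v where e: "e = {u, v}" "u \<noteq> v" "u \<in> V" "v \<in> V"
    using insert.prems(1) by (auto simp: card_2_iff)
  have sep: "\<not> ?R\<^sup>*\<^sup>* u v"
    using acyclic_edge_separates insert.prems(2) insert.hyps(2) e by metis
  have up: "?R'\<^sup>*\<^sup>* a b" if "?R\<^sup>*\<^sup>* a b" for a b
    using adj_rtranclp_mono[OF that, of "(V, insert e F)"] by auto
  have uv: "?R' u v" using e by (simp add: adj_def)
  \<comment> \<open>If \<open>s\<close> reached \<open>u\<close> and \<open>t\<close> reached
    \<open>v\<close> without \<open>e\<close>, then \<open>e\<close> would join \<open>s\<close> to
    \<open>t\<close>. Hence \<open>s = t\<close>, and \<open>u\<close> would reach \<open>v\<close>
    without \<open>e\<close>.\<close>
  have "\<exists>w\<in>{u, v}. \<forall>s\<in>S. \<not> ?R\<^sup>*\<^sup>* s w"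
  proof (rule ccontr)
    assume "\<not> ?thesis"
    then obtain s t where st: "s \<in> S" "t \<in> S" "?R\<^sup>*\<^sup>* s u" "?R\<^sup>*\<^sup>* t v" by blast
    have "?R'\<^sup>*\<^sup>* s v" using up[OF st(3)] uv by (rule rtranclp.rtrancl_into_rtrancl)
    then have "?R'\<^sup>*\<^sup>* s t" using reach_sym[OF up[OF st(4)]] by (rule rtranclp_trans)
    then have "s = t" using insert.prems(4) st by blast
    then show False using rtranclp_trans[OF reach_sym[OF st(3)]] st(4) sep by blast
  qed
  then obtain w where w: "w \<in> V" "\<And>s. s \<in> S \<Longrightarrow> \<not> ?R\<^sup>*\<^sup>* s w" using e by blast
  have "card F + card (insert w S) \<le> card V"
  proof (rule insert.IH)
    show "acyclic_graph (V, F)" using insert.prems(2) by (rule acyclic_graph_mono) auto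
    show "s = t" if "s \<in> insert w S" "t \<in> insert w S" "?R\<^sup>*\<^sup>* s t" for s t
      using that(1,2) w(2) that(3) reach_sym[OF that(3)] up[OF that(3)] insert.prems(4)[of s t]
      by blast
  qed (use insert.prems w in auto)
  moreover have "w \<notin> S" using w(2) by blast
  moreover have "finite S" using insert.prems(3) assms(2) finite_subset by blast
  ultimately show ?case using insert.hyps by simp
qed

text \<open>This is where maximality of a component enters: absorbing one more edge at a vertex of
  \<open>C\<close> keeps it connected, so it cannot enlarge \<open>C\<close>.\<close>

lemma component_reach_closed:
  assumes "simple_graph G" "C \<in> graph_components G" "x \<in> verts C" "(adj G)\<^sup>*\<^sup>* x y"
  shows "y \<in> verts C"
  using assms(4)
proof (induction rule: rtranclp_induct)
  case base
  show ?case by (rule assms)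
next
  case (step y z)
  \<comment> \<open>The single edge from \<open>y\<close> to \<open>z\<close>, viewed as a connected
    subgraph that meets \<open>C\<close> in \<open>y\<close>.\<close>
  let ?e = "({y, z}, {{y, z}})"
  let ?U = "(verts C \<union> verts ?e, edges C \<union> edges ?e)"
  have C: "C \<in> connected_subgraphs G" using assms(2) unfolding graph_components_def by blast
  have "adj ?e y z" "adj ?e z y" by (auto simp: adj_def)
  then have "connected_graph ?e" unfolding connected_graph_def by auto
  then have "?e \<in> connected_subgraphs G"
    using simple_adjD[OF assms(1) step.hyps(2)] step.hyps(2)
    unfolding connected_subgraphs_def subgraph_def adj_def by auto
  then have "?U \<in> connected_subgraphs G"
    using step.IH by (intro connected_subgraphs_Un[OF C]) auto
  moreover have "subgraph C ?U"
    using C unfolding connected_subgraphs_def subgraph_def by auto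
  ultimately have "?U = C" using assms(2) unfolding graph_components_def by blast
  then have "verts ?U = verts C" by (rule arg_cong)
  then show ?case by auto
qed

lemma forest_edges_plus_components_le:
  assumes "simple_graph G" "acyclic_graph G"
  shows "card (edges G) + card (graph_components G) \<le> card (verts G)"
proof -
  \<comment> \<open>One representative per component. Reachability between two of them forces equal
    components, as components are closed under reachability and pairwise disjoint.\<close>
  let ?r = "\<lambda>C. SOME x. x \<in> verts C"
  have comp: "verts C \<subseteq> verts G \<and> ?r C \<in> verts C" if "C \<in> graph_components G" for C
  proof -
    have "verts C \<subseteq> verts G" "verts C \<noteq> {}"
      using that unfolding graph_components_def connected_subgraphs_def subgraph_def
        connected_graph_def by auto
    then show ?thesis by (auto simp: some_in_eq)
  qed
  have eq: "C = D" if "C \<in> graph_components G" "D \<in> graph_components G"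
    "(adj G)\<^sup>*\<^sup>* (?r C) (?r D)" for C D
    using component_reach_closed[OF assms(1)] comp that graph_components_disjoint by blast
  then have "inj_on ?r (graph_components G)"
    by (intro inj_onI) (metis rtranclp.rtrancl_refl)
  then have "card (?r ` graph_components G) = card (graph_components G)" by (rule card_image)
  moreover have "card (edges G) + card (?r ` graph_components G) \<le> card (verts G)"
  proof (rule forest_edges_plus_unreachable_le)
    show "s = t" if "s \<in> ?r ` graph_components G" "t \<in> ?r ` graph_components G"
      "(adj (verts G, edges G))\<^sup>*\<^sup>* s t" for s t
      using that eq by auto
    show "?r ` graph_components G \<subseteq> verts G" using comp by blast
    show "finite (edges G)" using assms(1) by (rule finite_edges)
  qed (use assms in \<open>simp_all add: simple_graph_def\<close>)
  ultimately show ?thesis by simp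
qed

subsection \<open>Connected subgraphs as edge sets\<close>

text \<open>These sets encode the connected subgraphs with at least one edge, whose vertices are
  determined by their edges. The single vertices are counted separately.\<close>

definition connected_edge_sets :: "'a graph \<Rightarrow> 'a set set set" where
  "connected_edge_sets G = {E. E \<subseteq> edges G \<and> E \<noteq> {} \<and> connected_graph (\<Union>E, E)}"

text \<open>Some edge of \<open>H\<close> has an end other than \<open>x\<close>, so
  \<open>x\<close> must reach a different vertex; the first step of that walk is an edge at
  \<open>x\<close>.\<close>

lemma connected_verts_eq_Union_edges:
  assumes "simple_graph G" "H \<in> connected_subgraphs G" "edges H \<noteq> {}"
  shows "verts H = \<Union>(edges H)"
proof
  have H: "edges H \<subseteq> edges G" "\<And>e. e \<in> edges H \<Longrightarrow> e \<subseteq> verts H" "connected_graph H"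
    using assms(2) unfolding connected_subgraphs_def subgraph_def by auto
  then show "\<Union>(edges H) \<subseteq> verts H" by blast
  show "verts H \<subseteq> \<Union>(edges H)"
  proof
    fix x assume x: "x \<in> verts H"
    obtain e where "e \<in> edges H" using assms(3) by blast
    moreover obtain a b where "e = {a, b}" "a \<noteq> b"
      using edge_cases[OF assms(1)] H(1) \<open>e \<in> edges H\<close> by blast
    ultimately obtain y where "y \<in> verts H" "y \<noteq> x" using H(2) by blast
    then have "(adj H)\<^sup>*\<^sup>* x y" using H(3) x unfolding connected_graph_def by blast
    then obtain z where "adj H x z" using \<open>y \<noteq> x\<close> by (metis converse_rtranclpE)
    then show "x \<in> \<Union>(edges H)" unfolding adj_def by blast
  qed
qed

lemma connected_edgeless_singleton:
  assumes "connected_graph H" "edges H = {}"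
  shows "\<exists>x. H = ({x}, {})"
proof -
  obtain x where x: "x \<in> verts H" using assms(1) unfolding connected_graph_def by blast
  have "y = x" if "y \<in> verts H" for y
  proof -
    have "(adj H)\<^sup>*\<^sup>* x y" using assms(1) x that unfolding connected_graph_def by blast
    then show ?thesis using assms(2) by (cases rule: converse_rtranclpE) (auto simp: adj_def)
  qed
  then have "verts H = {x}" using x by blast
  then show ?thesis using assms(2) by (auto simp: prod_eq_iff)
qed

text \<open>The edgeless connected subgraphs correspond to the vertices of \<open>G\<close>, all
  others to their edge sets.\<close>

lemma core_index_eq:
  assumes "simple_graph G"
  shows "core_index G = card (verts G) + card (connected_edge_sets G)"
proof -
  let ?A = "(\<lambda>x. ({x}, {})) ` verts G" and ?B = "(\<lambda>E. (\<Union>E, E)) ` connected_edge_sets G"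
  have fin: "finite (verts G)" "finite (connected_edge_sets G)"
    using assms finite_edges[OF assms] unfolding simple_graph_def connected_edge_sets_def by auto
  have "connected_subgraphs G = ?A \<union> ?B"
  proof
    show "connected_subgraphs G \<subseteq> ?A \<union> ?B"
    proof
      fix H assume H: "H \<in> connected_subgraphs G"
      then have sub: "verts H \<subseteq> verts G" "edges H \<subseteq> edges G" and con: "connected_graph H"
        unfolding connected_subgraphs_def subgraph_def by auto
      show "H \<in> ?A \<union> ?B"
      proof (cases "edges H = {}")
        case True
        then show ?thesis using connected_edgeless_singleton[OF con] sub by auto
      next
        case False
        then have eq: "(\<Union>(edges H), edges H) = H"
          using connected_verts_eq_Union_edges[OF assms H] by (simp add: prod_eq_iff)
        have "edges H \<in> connected_edge_sets G"
          using False sub con unfolding connected_edge_sets_def by (simp add: eq)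
        then have "(\<Union>(edges H), edges H) \<in> ?B" by (rule imageI)
        then show ?thesis unfolding eq by (rule UnI2)
      qed
    qed
    have "?A \<subseteq> connected_subgraphs G"
      unfolding connected_subgraphs_def subgraph_def connected_graph_def by auto
    moreover have "(\<Union>E, E) \<in> connected_subgraphs G" if "E \<in> connected_edge_sets G" for E
    proof -
      have E: "E \<subseteq> edges G" "connected_graph (\<Union>E, E)"
        using that unfolding connected_edge_sets_def by auto
      moreover have "\<Union>E \<subseteq> verts G" using E(1) assms unfolding simple_graph_def by blast
      ultimately show ?thesis unfolding connected_subgraphs_def subgraph_def by auto
    qed
    ultimately show "?A \<union> ?B \<subseteq> connected_subgraphs G" by blast
  qed
  moreover have "?A \<inter> ?B = {}" unfolding connected_edge_sets_def by auto
  moreover have "card ?A = card (verts G)" "card ?B = card (connected_edge_sets G)"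
    by (auto intro!: card_image inj_onI)
  ultimately show ?thesis unfolding core_index_def using fin by (simp add: card_Un_disjoint)
qed

section \<open>The bound on connected edge sets and its equality case\<close>

lemma connected_edge_sets_subset: "connected_edge_sets G \<subseteq> Pow (edges G) - {{}}"
  unfolding connected_edge_sets_def by auto

lemma card_nonempty_subsets: "finite A \<Longrightarrow> card (Pow A - {{}}) = 2 ^ card A - 1"
  by (simp add: card_Pow)

lemma card_connected_edge_sets_le:
  "simple_graph G \<Longrightarrow> card (connected_edge_sets G) \<le> 2 ^ card (edges G) - 1"
  using card_mono[OF _ connected_edge_sets_subset, of G] finite_edges[of G]
    card_nonempty_subsets[of "edges G"] by simp

lemma card_connected_edge_sets_eq_iff:
  assumes "simple_graph G"
  shows "card (connected_edge_sets G) = 2 ^ card (edges G) - 1 \<longleftrightarrow>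
    connected_edge_sets G = Pow (edges G) - {{}}"
  using card_subset_eq[OF _ connected_edge_sets_subset, of G] finite_edges[OF assms]
    card_nonempty_subsets by (metis finite_Diff finite_Pow_iff)

text \<open>If \<open>d\<close> and \<open>e\<close> were disjoint, a walk starting in
  \<open>d\<close> could never leave \<open>d\<close>.\<close>

lemma connected_two_edges_meet:
  assumes "connected_graph (\<Union>{d, e}, {d, e})" "d \<noteq> {}" "e \<noteq> {}"
  shows "d \<inter> e \<noteq> {}"
proof
  assume disj: "d \<inter> e = {}"
  obtain x y where xy: "x \<in> d" "y \<in> e" using assms(2,3) by blast
  then have "(adj (\<Union>{d, e}, {d, e}))\<^sup>*\<^sup>* x y"
    using assms(1) unfolding connected_graph_def by auto
  then have "y \<in> d"
    by (induction rule: rtranclp_induct) (use xy(1) disj in \<open>auto simp: adj_def\<close>)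
  then show False using xy(2) disj by blast
qed

text \<open>Each vertex covered by \<open>E\<close> is \<open>c\<close> itself or adjacent to
  \<open>c\<close>, so any two are joined through \<open>c\<close>.\<close>

lemma common_vertex_connected:
  assumes "simple_graph G" "E \<subseteq> edges G" "E \<noteq> {}" "\<forall>e\<in>E. c \<in> e"
  shows "connected_graph (\<Union>E, E)"
proof -
  let ?R = "adj (\<Union>E, E)"
  have c: "?R\<^sup>*\<^sup>* x c" if x: "x \<in> \<Union>E" for x
  proof (cases "x = c")
    case False
    obtain e where e: "e \<in> E" "x \<in> e" using x by blast
    have "e \<in> edges G" using e(1) assms(2) by blast
    then obtain y where y: "e = {x, y}" using edge_through[OF assms(1) _ e(2)] by metis
    have "c \<in> e" using assms(4) e(1) by blast
    then have "e = {x, c}" using False y by simp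
    then have "?R x c" using e(1) by (simp add: adj_def)
    then show ?thesis by (rule r_into_rtranclp)
  qed simp
  have "?R\<^sup>*\<^sup>* x y" if "x \<in> \<Union>E" "y \<in> \<Union>E" for x y
    using rtranclp_trans[OF c[OF that(1)] reach_sym[OF c[OF that(2)]]] .
  moreover have "\<Union>E \<noteq> {}" using assms(3,4) by blast
  ultimately show ?thesis unfolding connected_graph_def by simp
qed

text \<open>Pairwise meeting edges without a common vertex contain a triangle, which acyclicity
  forbids.\<close>

lemma pairwise_meeting_edges_common_vertex:
  assumes "simple_graph G" "acyclic_graph G" "verts G \<noteq> {}"
    and meet: "\<And>d e. \<lbrakk>d \<in> edges G; e \<in> edges G\<rbrakk> \<Longrightarrow> d \<inter> e \<noteq> {}"
  shows "\<exists>c\<in>verts G. \<forall>e\<in>edges G. c \<in> e"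
proof (rule ccontr)
  assume none: "\<not> ?thesis"
  \<comment> \<open>Without edges, any vertex would be common vacuously.\<close>
  then obtain e where "e \<in> edges G" using assms(3) by blast
  then obtain a b where ab: "e = {a, b}" "a \<noteq> b" "a \<in> verts G" "b \<in> verts G"
    using edge_cases[OF assms(1)] by metis
  \<comment> \<open>Neither end of \<open>e\<close> is common: \<open>f\<close> misses
    \<open>a\<close> and so meets \<open>e\<close> in \<open>b\<close>, while \<open>g\<close>
    misses \<open>b\<close> and meets \<open>e\<close> in \<open>a\<close>.\<close>
  obtain f g where f: "f \<in> edges G" "a \<notin> f" and g: "g \<in> edges G" "b \<notin> g"
    using none ab by blast
  have "b \<in> f" "a \<in> g"
    using meet[OF \<open>e \<in> edges G\<close> f(1)] meet[OF \<open>e \<in> edges G\<close> g(1)] f(2) g(2) ab(1) by auto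
  obtain x where x: "f = {b, x}" "b \<noteq> x" using edge_through[OF assms(1) f(1) \<open>b \<in> f\<close>] .
  obtain y where y: "g = {a, y}" "a \<noteq> y" using edge_through[OF assms(1) g(1) \<open>a \<in> g\<close>] .
  \<comment> \<open>\<open>f\<close> and \<open>g\<close> can meet neither in \<open>a\<close> nor
    in \<open>b\<close>, so they share their other ends. This third vertex closes the
    triangle.\<close>
  have "x = y" using meet[OF f(1) g(1)] x y f(2) g(2) by auto
  then have "adj G a b" "adj G b x" "adj G x a" "a \<noteq> x"
    using \<open>e \<in> edges G\<close> ab(1) f(1) x(1) g(1) y by (auto simp: adj_def insert_commute)
  then have "is_cycle G [a, b, x]" using ab(2) x(2) unfolding is_cycle_def by simp
  then show False using assms(2) unfolding acyclic_graph_def by blast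
qed

text \<open>From left to right only the sets \<open>{d, e}\<close> matter: their connectedness makes
  any two edges meet.\<close>

lemma all_edge_sets_connected_iff:
  assumes "simple_graph G" "acyclic_graph G" "verts G \<noteq> {}"
  shows "connected_edge_sets G = Pow (edges G) - {{}} \<longleftrightarrow>
    (\<exists>c\<in>verts G. \<forall>e\<in>edges G. c \<in> e)"
proof
  assume all: "connected_edge_sets G = Pow (edges G) - {{}}"
  show "\<exists>c\<in>verts G. \<forall>e\<in>edges G. c \<in> e"
  proof (rule pairwise_meeting_edges_common_vertex[OF assms])
    fix d e assume de: "d \<in> edges G" "e \<in> edges G"
    then have "{d, e} \<in> connected_edge_sets G" using all by auto
    then have "connected_graph (\<Union>{d, e}, {d, e})"
      unfolding connected_edge_sets_def mem_Collect_eq by (elim conjE)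
    moreover have "d \<noteq> {}" "e \<noteq> {}" using de assms(1) unfolding simple_graph_def by auto
    ultimately show "d \<inter> e \<noteq> {}" by (rule connected_two_edges_meet)
  qed
next
  assume "\<exists>c\<in>verts G. \<forall>e\<in>edges G. c \<in> e"
  then obtain c where c: "\<forall>e\<in>edges G. c \<in> e" by blast
  have "connected_graph (\<Union>E, E)" if "E \<subseteq> edges G" "E \<noteq> {}" for E
    using common_vertex_connected[OF assms(1) that, of c] c that(1) by blast
  then show "connected_edge_sets G = Pow (edges G) - {{}}"
    unfolding connected_edge_sets_def by auto
qed

subsection \<open>Stars with isolated vertices up to isomorphism\<close>

text \<open>A star with centre \<open>c\<close> and leaf set \<open>N\<close>, plus isolated
  vertices. \<open>N\<close> may be empty, and then any vertex serves as centre, which covers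
  edgeless graphs.\<close>

definition star_at :: "'a graph \<Rightarrow> 'a \<Rightarrow> 'a set \<Rightarrow> bool" where
  "star_at G c N \<longleftrightarrow> c \<in> verts G \<and> N \<subseteq> verts G - {c} \<and> edges G = (\<lambda>x. {c, x}) ` N"

lemma star_at_adj: "star_at G c N \<Longrightarrow> adj G u v \<longleftrightarrow> u = c \<and> v \<in> N \<or> v = c \<and> u \<in> N"
  unfolding star_at_def adj_def by (auto simp: doubleton_eq_iff)

lemma star_at_card_edges:
  assumes "star_at G c N"
  shows "card (edges G) = card N"
proof -
  have "inj_on (\<lambda>x. {c, x}) N" by (rule inj_onI) (auto simp: doubleton_eq_iff)
  then show ?thesis using assms unfolding star_at_def by (simp add: card_image)
qed

text \<open>The leaf set is the neighbourhood of \<open>c\<close>, which omits \<open>c\<close>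
  because edges have two distinct ends.\<close>

lemma common_vertex_iff_star_at:
  assumes "simple_graph G"
  shows "(c \<in> verts G \<and> (\<forall>e\<in>edges G. c \<in> e)) \<longleftrightarrow> (\<exists>N. star_at G c N)"
proof
  assume c: "c \<in> verts G \<and> (\<forall>e\<in>edges G. c \<in> e)"
  have "edges G \<subseteq> (\<lambda>x. {c, x}) ` {x. adj G c x}"
  proof
    fix e assume e: "e \<in> edges G"
    then obtain x where "e = {c, x}" using edge_through[OF assms e, of c] c by blast
    then show "e \<in> (\<lambda>x. {c, x}) ` {x. adj G c x}" using e by (auto simp: adj_def)
  qed
  moreover have "(\<lambda>x. {c, x}) ` {x. adj G c x} \<subseteq> edges G" by (auto simp: adj_def)
  moreover have "{x. adj G c x} \<subseteq> verts G - {c}" using simple_adjD[OF assms, of c] by auto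
  ultimately have "star_at G c {x. adj G c x}" using c unfolding star_at_def by blast
  then show "\<exists>N. star_at G c N" ..
qed (auto simp: star_at_def)

text \<open>The preimage of \<open>d\<close> is a centre of \<open>G\<close>. Leaves are exactly the
  neighbours of the centre, so the isomorphism maps \<open>N\<close> bijectively onto
  \<open>M\<close>.\<close>

lemma star_at_iso_transfer:
  assumes "simple_graph G" "graph_iso G H" "star_at H d M"
  shows "\<exists>c N. star_at G c N \<and> card N = card M"
proof -
  obtain f where f: "bij_betw f (verts G) (verts H)"
    and adj: "\<And>u v. \<lbrakk>u \<in> verts G; v \<in> verts G\<rbrakk> \<Longrightarrow> adj G u v \<longleftrightarrow> adj H (f u) (f v)"
    using assms(2) unfolding graph_iso_def by blast
  have d: "d \<in> verts H" "M \<subseteq> verts H" "d \<notin> M" using assms(3) unfolding star_at_def by auto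
  have inj: "inj_on f (verts G)" and im: "f ` verts G = verts H"
    using f by (auto simp: bij_betw_def)
  obtain c where c: "c \<in> verts G" "f c = d" using im d(1) by (metis imageE)
  have "c \<in> e" if e: "e \<in> edges G" for e
  proof -
    obtain u v where uv: "e = {u, v}" "u \<in> verts G" "v \<in> verts G"
      using edge_cases[OF assms(1) e] by metis
    then have "adj H (f u) (f v)" using adj[OF uv(2,3)] e by (simp add: adj_def)
    then have "f u = f c \<or> f v = f c" unfolding star_at_adj[OF assms(3)] c(2) by blast
    then show ?thesis using inj_on_eq_iff[OF inj] c(1) uv by auto
  qed
  then obtain N where N: "star_at G c N" using common_vertex_iff_star_at[OF assms(1)] c(1) by blast
  then have NV: "N \<subseteq> verts G" "c \<notin> N" unfolding star_at_def by auto
  have iff: "x \<in> N \<longleftrightarrow> f x \<in> M" if "x \<in> verts G" for x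
    using adj[OF c(1) that] NV(2) d(3)
    unfolding star_at_adj[OF N] star_at_adj[OF assms(3)] c(2) by blast
  have "f ` N = M"
  proof
    show "f ` N \<subseteq> M" using iff NV(1) by blast
    show "M \<subseteq> f ` N"
    proof
      fix y assume y: "y \<in> M"
      then obtain x where "x \<in> verts G" "y = f x" using d(2) im by (metis imageE subsetD)
      then show "y \<in> f ` N" using iff y by blast
    qed
  qed
  then have "card N = card M" using card_image[OF inj_on_subset[OF inj NV(1)]] by simp
  then show ?thesis using N by blast
qed

text \<open>Such a graph is determined up to isomorphism by its numbers of vertices and leaves:
  bijections between the centres, the leaves and the isolated vertices are glued together.\<close>

lemma star_at_iso:
  assumes "star_at G c N" "star_at H d M" "finite (verts G)" "finite (verts H)"
    and "card (verts G) = card (verts H)" "card N = card M"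
  shows "graph_iso G H"
proof -
  have G: "c \<in> verts G" "N \<subseteq> verts G" "c \<notin> N" using assms(1) unfolding star_at_def by auto
  have H: "d \<in> verts H" "M \<subseteq> verts H" "d \<notin> M" using assms(2) unfolding star_at_def by auto
  have fin: "finite N" "finite M" using G H assms(3,4) finite_subset by auto
  obtain g where g: "bij_betw g N M" using finite_same_card_bij[OF fin assms(6)] by blast
  have "card (verts G - insert c N) = card (verts H - insert d M)"
    using G H fin assms(3-6) by (simp add: card_Diff_subset)
  then obtain h where h: "bij_betw h (verts G - insert c N) (verts H - insert d M)"
    using finite_same_card_bij assms(3,4) by blast
  define f where "f x = (if x = c then d else if x \<in> N then g x else h x)" for x
  have "bij_betw f {c} {d}" by (auto simp: f_def bij_betw_def)
  moreover have fN: "bij_betw f N M"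
    using g G(3) by (subst bij_betw_cong[of N f g]) (auto simp: f_def)
  ultimately have cN: "bij_betw f ({c} \<union> N) ({d} \<union> M)"
    using H(3) by (intro bij_betw_combine) auto
  have "bij_betw f (verts G - insert c N) (verts H - insert d M)"
    using h by (subst bij_betw_cong[of _ f h]) (auto simp: f_def)
  then have "bij_betw f (({c} \<union> N) \<union> (verts G - insert c N)) (({d} \<union> M) \<union> (verts H - insert d M))"
    by (intro bij_betw_combine[OF cN]) auto
  moreover have "({c} \<union> N) \<union> (verts G - insert c N) = verts G" using G by blast
  moreover have "({d} \<union> M) \<union> (verts H - insert d M) = verts H" using H by blast
  ultimately have f: "bij_betw f (verts G) (verts H)" by simp
  then have inj: "inj_on f (verts G)" by (rule bij_betw_imp_inj_on)
  have fc: "f c = d" by (simp add: f_def)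
  have d_iff: "f x = d \<longleftrightarrow> x = c" if "x \<in> verts G" for x
    using inj_onD[OF inj _ that G(1)] fc by auto
  \<comment> \<open>With \<open>d_iff\<close>, this turns adjacency, which only depends on being the
    centre or a leaf, into the same condition on the images.\<close>
  have M_iff: "f x \<in> M \<longleftrightarrow> x \<in> N" if "x \<in> verts G" for x
    using bij_betw_imp_surj_on[OF fN] inj_on_image_mem_iff[OF inj that G(2)] by simp
  have "adj G u v \<longleftrightarrow> adj H (f u) (f v)" if "u \<in> verts G" "v \<in> verts G" for u v
    using that by (simp add: star_at_adj[OF assms(1)] star_at_adj[OF assms(2)] d_iff M_iff)
  then show ?thesis using f unfolding graph_iso_def by blast
qed

section \<open>The extremal graph\<close>

lemma star_at_extremal:
  "star_at (disjoint_union (graph_copies j K1) (star_graph m)) (Inr 0) (Inr ` {1..m})"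
  unfolding star_at_def disjoint_union_def graph_copies_def K1_def star_graph_def
  by (auto simp: image_image)

lemma verts_extremal:
  fixes j m :: nat
  defines "V \<equiv> verts (disjoint_union (graph_copies j K1) (star_graph m))"
  shows "finite V" "card V = j + (m + 1)"
  unfolding V_def disjoint_union_def graph_copies_def K1_def star_graph_def
  by (auto simp: card_Plus)

text \<open>Both graphs have \<open>j + (m + 1)\<close> vertices, so only the star shape and the
  number of leaves, which equals the number of edges, remain to be compared.\<close>

lemma graph_iso_extremal_iff:
  assumes "simple_graph G" "card (verts G) = j + (m + 1)"
  shows "graph_iso G (disjoint_union (graph_copies j K1) (star_graph m)) \<longleftrightarrow>
    (\<exists>c\<in>verts G. \<forall>e\<in>edges G. c \<in> e) \<and> card (edges G) = m"
    (is "graph_iso G ?H \<longleftrightarrow> ?R")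
proof -
  have card: "card (Inr ` {1..m} :: (nat \<times> nat + nat) set) = m" by (simp add: card_image)
  show ?thesis
  proof
    assume "graph_iso G ?H"
    then obtain c N where "star_at G c N" "card N = m"
      using star_at_iso_transfer[OF assms(1) _ star_at_extremal] card by metis
    then show ?R using common_vertex_iff_star_at[OF assms(1)] star_at_card_edges by metis
  next
    assume ?R
    then obtain c N where "star_at G c N" "card N = m"
      using common_vertex_iff_star_at[OF assms(1)] star_at_card_edges by metis
    moreover have "finite (verts G)" using assms(1) unfolding simple_graph_def by blast
    ultimately show "graph_iso G ?H"
      using star_at_iso[OF _ star_at_extremal] card assms(2) verts_extremal by metis
  qed
qed

theorem theorem2p7:
  fixes G :: "'a graph" and n k :: nat
  assumes "1 \<le> k" and "k \<le> n"
    and "simple_graph G" and "acyclic_graph G"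
    and "card (verts G) = n"
    and "card (graph_components G) = k"
  shows "core_index G \<le> 2 ^ (n - k) + n - 1 \<and>
    (core_index G = 2 ^ (n - k) + n - 1 \<longleftrightarrow>
      graph_iso G (disjoint_union (graph_copies (k - 1) K1) (star_graph (n - k))))"
proof -
  let ?m = "card (edges G)" and ?c = "card (connected_edge_sets G)"
  have core: "core_index G = n + ?c" using core_index_eq[OF assms(3)] assms(5) by simp
  have le: "?c \<le> 2 ^ ?m - 1" by (rule card_connected_edge_sets_le[OF assms(3)])
  have m: "?m \<le> n - k" using forest_edges_plus_components_le[OF assms(3,4)] assms(5,6) by simp
  then have pow: "(2::nat) ^ ?m \<le> 2 ^ (n - k)" by simp
  \<comment> \<open>Positivity makes the truncated subtractions of 1 exact in the arithmetic
    below.\<close>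
  have pos: "(0::nat) < 2 ^ i" for i by simp
  have "verts G \<noteq> {}" using assms(1,2,5) by auto
  then have all: "?c = 2 ^ ?m - 1 \<longleftrightarrow> (\<exists>c\<in>verts G. \<forall>e\<in>edges G. c \<in> e)"
    unfolding card_connected_edge_sets_eq_iff[OF assms(3)]
    by (rule all_edge_sets_connected_iff[OF assms(3,4)])
  \<comment> \<open>The vertex counts agree since \<open>(k - 1) + ((n - k) + 1) = n\<close>, where
    \<open>1 \<le> k\<close> and \<open>k \<le> n\<close> keep both subtractions exact.\<close>
  have iso: "graph_iso G (disjoint_union (graph_copies (k - 1) K1) (star_graph (n - k))) \<longleftrightarrow>
      ?c = 2 ^ ?m - 1 \<and> ?m = n - k"
    unfolding all by (rule graph_iso_extremal_iff[OF assms(3)]) (use assms(1,2,5) in simp)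
  have "core_index G = 2 ^ (n - k) + n - 1 \<longleftrightarrow> ?c = 2 ^ (n - k) - 1"
    using core pos[of "n - k"] by linarith
  also have "\<dots> \<longleftrightarrow> ?c = 2 ^ ?m - 1 \<and> ?m = n - k"
  proof
    assume c: "?c = 2 ^ (n - k) - 1"
    \<comment> \<open>In the chain \<open>?c \<le> 2 ^ ?m - 1 \<le> 2 ^ (n - k) - 1\<close> the
      outer terms now agree, so both inequalities are equalities; equal powers of 2 then have equal
      exponents.\<close>
    then have "(2::nat) ^ (n - k) = 2 ^ ?m" using le pow pos[of "n - k"] pos[of ?m] by linarith
    then show "?c = 2 ^ ?m - 1 \<and> ?m = n - k" using c by simp
  qed simp
  finally have "core_index G = 2 ^ (n - k) + n - 1 \<longleftrightarrow>
      graph_iso G (disjoint_union (graph_copies (k - 1) K1) (star_graph (n - k)))"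
    unfolding iso .
  moreover have "core_index G \<le> 2 ^ (n - k) + n - 1"
    using core le pow pos[of "n - k"] by linarith
  ultimately show ?thesis by blast
qed

end
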